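(* Let $R$ be a Leibniz conformal algebra and $Q$ a $\mathbb{C}[\partial]$-module. Set $E=R\oplus Q$ (direct sum of $\mathbb{C}[\partial]$-modules). Suppose that $E$ has a Leibniz conformal algebra structure $[\cdot_\lambda\cdot]$ such that $R$ is a subalgebra. Then there exist a Leibniz conformal extending structure $\Omega(R,Q)=(\leftharpoonup_\lambda,\rightharpoonup_\lambda,\lhd_\lambda,\rhd_\lambda,f_\lambda,\{\cdot_\lambda\cdot\})$ of $R$ by $Q$ and an isomorphism of Leibniz conformal algebras between $E$ and $R\natural Q$ which stabilizes $R$ and co-stabilizes $Q$ (that is, $E\approx R\natural Q$).
   Context: All vector spaces are over $\mathbb{C}$; $A[\lambda]$ denotes polynomials in $\lambda$ with coefficients in $A$. Maps with values in polynomials are extended coefficientwise to polynomial arguments in other indeterminates. Conformal bilinear map: for $\mathbb{C}[\partial]$-modules $U,V,W$, a $\mathbb{C}$-bilinear map $f_\lambda:U\times V\to W[\lambda]$ with $f_\lambda(\partial u,v)=-\lambda f_\lambda(u,v)$ and $f_\lambda(u,\partial v)=(\partial+\lambda)f_\lambda(u,v)$. Leibniz conformal algebra: a $\mathbb{C}[\partial]$-module $R$ with a conformal bilinear map $[\cdot_\lambda\cdot]:R\times R\to R[\lambda]$ satisfying $[a_\lambda[b_\mu c]]=[[a_\lambda b]_{\lambda+\mu}c]+[b_\mu[a_\lambda c]]$. "$R$ is a subalgebra of $E$" means the bracket of $E$ restricts on $R$ to the given bracket of $R$. Isomorphisms are bijective $\mathbb{C}[\partial]$-module homomorphisms preserving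 the $\lambda$-brackets. Extending datum of $R$ by $Q$: six conformal bilinear maps $\leftharpoonup_\lambda:R\times Q\to R[\lambda]$, $\rightharpoonup_\lambda:R\times Q\to Q[\lambda]$, $\lhd_\lambda:Q\times R\to Q[\lambda]$, $\rhd_\lambda:Q\times R\to R[\lambda]$, $f_\lambda:Q\times Q\to R[\lambda]$, $\{\cdot_\lambda\cdot\}:Q\times Q\to Q[\lambda]$. $R\natural Q$ is the $\mathbb{C}[\partial]$-module $R\times Q$ with $[(a,x)_\lambda(b,y)]=([a_\lambda b]+a\leftharpoonup_\lambda y+x\rhd_\lambda b+f_\lambda(x,y),\ a\rightharpoonup_\lambda y+x\lhd_\lambda b+\{x_\lambda y\})$. If this is a Leibniz conformal algebra, $\Omega(R,Q)$ is called a Leibniz conformal extending structure and $R\natural Q$ the unified product. Identify $R\times Q$ with $E=R\oplus Q$ via $(a,x)\mapsto a+x$. A map $\varphi:E\to E$ stabilizes $R$ if $\varphi(a)=a$ for all $a\in R$, and co-stabilizes $Q$ if $\pi\circ\varphi=\pi$, where $\pi:E\to Q$ is the natural projection. *)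

theory Defs
  imports "HOL-Analysis.Product_Vector" "HOL-Computational_Algebra.Polynomial"
begin

text \<open>
  A module over the ring of complex polynomials in the indeterminate \<open>\<partial>\<close> is given by the library
  locale \<^locale>\<open>module\<close> at scalar type \<open>complex poly\<close>. For an additive group \<open>'w\<close>, the group of
  polynomials in \<open>\<lambda>\<close> with coefficients in \<open>'w\<close> is \<open>'w poly\<close>, in which multiplication by \<open>\<lambda>\<close>
  is \<open>pCons 0\<close>; scalars and \<open>\<partial>\<close> act on it coefficientwise, by \<^const>\<open>map_poly\<close>.
\<close>

abbreviation del :: "(complex poly \<Rightarrow> 'u \<Rightarrow> 'u) \<Rightarrow> 'u \<Rightarrow> 'u"
  where "del s u \<equiv> s [:0, 1:] u"

abbreviation cscale :: "(complex poly \<Rightarrow> 'u \<Rightarrow> 'u) \<Rightarrow> complex \<Rightarrow> 'u \<Rightarrow> 'u"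
  where "cscale s c u \<equiv> s [:c:] u"

locale conformal_bilinear =
  U: module sU + V: module sV + W: module sW
  for sU :: "complex poly \<Rightarrow> 'u::ab_group_add \<Rightarrow> 'u"
    and sV :: "complex poly \<Rightarrow> 'v::ab_group_add \<Rightarrow> 'v"
    and sW :: "complex poly \<Rightarrow> 'w::ab_group_add \<Rightarrow> 'w" +
  fixes f :: "'u \<Rightarrow> 'v \<Rightarrow> 'w poly"
  assumes add_left: "f (u + u') v = f u v + f u' v"
    and add_right: "f u (v + v') = f u v + f u v'"
    and cscale_left: "f (cscale sU c u) v = map_poly (cscale sW c) (f u v)"
    and cscale_right: "f u (cscale sV c v) = map_poly (cscale sW c) (f u v)"
    and del_left: "f (del sU u) v = - pCons 0 (f u v)"
    and del_right: "f u (del sV v) = map_poly (del sW) (f u v) + pCons 0 (f u v)"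

text \<open>
  Polynomials in two indeterminates \<open>\<lambda>\<close>, \<open>\<mu>\<close> are elements of \<open>'w poly poly\<close>, with \<open>\<lambda>\<close> the inner
  and \<open>\<mu>\<close> the outer indeterminate.
\<close>

definition mul_lambda :: "'w::ab_group_add poly poly \<Rightarrow> 'w poly poly"
  where "mul_lambda = map_poly (pCons 0)"

definition mul_mu :: "'w::ab_group_add poly poly \<Rightarrow> 'w poly poly"
  where "mul_mu = pCons 0"

definition mul_lambda_mu :: "'w::ab_group_add poly poly \<Rightarrow> 'w poly poly"
  where "mul_lambda_mu p = mul_lambda p + mul_mu p"

definition const2 :: "'w::ab_group_add \<Rightarrow> 'w poly poly"
  where "const2 w = [:[:w:]:]"

text \<open>
  Apply \<open>g\<close> coefficientwise to \<open>p\<close>, replacing powers of the indeterminate of \<open>p\<close> by powers of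
  the operator \<open>T\<close> of multiplication by the intended polynomial argument.
\<close>

definition ext_subst ::
  "('w::ab_group_add poly poly \<Rightarrow> 'w poly poly) \<Rightarrow> ('v::zero \<Rightarrow> 'w poly poly) \<Rightarrow> 'v poly \<Rightarrow> 'w poly poly"
  where "ext_subst T g p = (\<Sum>k\<le>degree p. (T ^^ k) (g (coeff p k)))"

text \<open>The value of a bracket with its parameter replaced by the argument that \<open>T\<close> multiplies by.\<close>

definition bracket_at ::
  "('w::ab_group_add poly poly \<Rightarrow> 'w poly poly) \<Rightarrow> ('u \<Rightarrow> 'v \<Rightarrow> 'w poly) \<Rightarrow> 'u \<Rightarrow> 'v \<Rightarrow> 'w poly poly"
  where "bracket_at T br u v = ext_subst T const2 (br u v)"

locale leibniz_conformal_algebra =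
  conformal_bilinear s s s br
  for s :: "complex poly \<Rightarrow> 'r::ab_group_add \<Rightarrow> 'r" and br :: "'r \<Rightarrow> 'r \<Rightarrow> 'r poly" +
  assumes leibniz:
    "ext_subst mul_mu (\<lambda>v. bracket_at mul_lambda br a v) (br b c)
     = ext_subst mul_lambda (\<lambda>v. bracket_at mul_lambda_mu br v c) (br a b)
       + ext_subst mul_lambda (\<lambda>v. bracket_at mul_mu br b v) (br a c)"

definition leibniz_conformal_iso ::
  "(complex poly \<Rightarrow> 'a::ab_group_add \<Rightarrow> 'a) \<Rightarrow> ('a \<Rightarrow> 'a \<Rightarrow> 'a poly) \<Rightarrow>
   (complex poly \<Rightarrow> 'b::ab_group_add \<Rightarrow> 'b) \<Rightarrow> ('b \<Rightarrow> 'b \<Rightarrow> 'b poly) \<Rightarrow> ('a \<Rightarrow> 'b) \<Rightarrow> bool"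
  where "leibniz_conformal_iso sA brA sB brB \<phi> \<longleftrightarrow>
    module_hom sA sB \<phi> \<and> bij \<phi> \<and>
    (\<forall>u v. map_poly \<phi> (brA u v) = brB (\<phi> u) (\<phi> v))"

abbreviation prod_scale ::
  "(complex poly \<Rightarrow> 'r::ab_group_add \<Rightarrow> 'r) \<Rightarrow> (complex poly \<Rightarrow> 'q::ab_group_add \<Rightarrow> 'q) \<Rightarrow>
   complex poly \<Rightarrow> 'r \<times> 'q \<Rightarrow> 'r \<times> 'q"
  where "prod_scale sR sQ \<equiv> module_prod.scale sR sQ"

definition is_subalgebra_of_prod ::
  "('r::ab_group_add \<Rightarrow> 'r \<Rightarrow> 'r poly) \<Rightarrow>
   ('r \<times> 'q::ab_group_add \<Rightarrow> 'r \<times> 'q \<Rightarrow> ('r \<times> 'q) poly) \<Rightarrow> bool"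
  where "is_subalgebra_of_prod brR brE \<longleftrightarrow>
    (\<forall>a b. brE (a, 0) (b, 0) = map_poly (\<lambda>r. (r, 0)) (brR a b))"

locale extending_datum =
  R: leibniz_conformal_algebra sR brR + Q: module sQ +
  leftharp: conformal_bilinear sR sQ sR leftharp +
  rightharp: conformal_bilinear sR sQ sQ rightharp +
  ltri: conformal_bilinear sQ sR sQ ltri +
  rtri: conformal_bilinear sQ sR sR rtri +
  f: conformal_bilinear sQ sQ sR f +
  curly: conformal_bilinear sQ sQ sQ curly
  for sR :: "complex poly \<Rightarrow> 'r::ab_group_add \<Rightarrow> 'r" and brR :: "'r \<Rightarrow> 'r \<Rightarrow> 'r poly"
    and sQ :: "complex poly \<Rightarrow> 'q::ab_group_add \<Rightarrow> 'q"
    and leftharp :: "'r \<Rightarrow> 'q \<Rightarrow> 'r poly"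
    and rightharp :: "'r \<Rightarrow> 'q \<Rightarrow> 'q poly"
    and ltri :: "'q \<Rightarrow> 'r \<Rightarrow> 'q poly"
    and rtri :: "'q \<Rightarrow> 'r \<Rightarrow> 'r poly"
    and f :: "'q \<Rightarrow> 'q \<Rightarrow> 'r poly"
    and curly :: "'q \<Rightarrow> 'q \<Rightarrow> 'q poly"

text \<open>The identification of pairs of polynomials with polynomials whose coefficients are pairs.\<close>

definition pair_poly :: "'r::ab_group_add poly \<Rightarrow> 'q::ab_group_add poly \<Rightarrow> ('r \<times> 'q) poly"
  where "pair_poly p q = map_poly (\<lambda>r. (r, 0)) p + map_poly (\<lambda>x. (0, x)) q"

definition unified_bracket ::
  "('r::ab_group_add \<Rightarrow> 'r \<Rightarrow> 'r poly) \<Rightarrow>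
   ('r \<Rightarrow> 'q::ab_group_add \<Rightarrow> 'r poly) \<Rightarrow> ('r \<Rightarrow> 'q \<Rightarrow> 'q poly) \<Rightarrow>
   ('q \<Rightarrow> 'r \<Rightarrow> 'q poly) \<Rightarrow> ('q \<Rightarrow> 'r \<Rightarrow> 'r poly) \<Rightarrow>
   ('q \<Rightarrow> 'q \<Rightarrow> 'r poly) \<Rightarrow> ('q \<Rightarrow> 'q \<Rightarrow> 'q poly) \<Rightarrow>
   'r \<times> 'q \<Rightarrow> 'r \<times> 'q \<Rightarrow> ('r \<times> 'q) poly"
  where "unified_bracket brR leftharp rightharp ltri rtri f curly = (\<lambda>(a, x) (b, y).
    pair_poly
      (brR a b + leftharp a y + rtri x b + f x y)
      (rightharp a y + ltri x b + curly x y))"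

definition leibniz_conformal_extending_structure ::
  "(complex poly \<Rightarrow> 'r::ab_group_add \<Rightarrow> 'r) \<Rightarrow> ('r \<Rightarrow> 'r \<Rightarrow> 'r poly) \<Rightarrow>
   (complex poly \<Rightarrow> 'q::ab_group_add \<Rightarrow> 'q) \<Rightarrow>
   ('r \<Rightarrow> 'q \<Rightarrow> 'r poly) \<Rightarrow> ('r \<Rightarrow> 'q \<Rightarrow> 'q poly) \<Rightarrow>
   ('q \<Rightarrow> 'r \<Rightarrow> 'q poly) \<Rightarrow> ('q \<Rightarrow> 'r \<Rightarrow> 'r poly) \<Rightarrow>
   ('q \<Rightarrow> 'q \<Rightarrow> 'r poly) \<Rightarrow> ('q \<Rightarrow> 'q \<Rightarrow> 'q poly) \<Rightarrow> bool"
  where "leibniz_conformal_extending_structure sR brR sQ leftharp rightharp ltri rtri f curly \<longleftrightarrow>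
    extending_datum sR brR sQ leftharp rightharp ltri rtri f curly \<and>
    leibniz_conformal_algebra (prod_scale sR sQ)
      (unified_bracket brR leftharp rightharp ltri rtri f curly)"

definition stabilizes_left :: "('r \<times> 'q::zero \<Rightarrow> 'r \<times> 'q) \<Rightarrow> bool"
  where "stabilizes_left \<phi> \<longleftrightarrow> (\<forall>a. \<phi> (a, 0) = (a, 0))"

definition costabilizes_right :: "('r \<times> 'q \<Rightarrow> 'r \<times> 'q) \<Rightarrow> bool"
  where "costabilizes_right \<phi> \<longleftrightarrow> snd \<circ> \<phi> = snd"

end

theory Submission
  imports Defs
begin

text \<open>The bracket of E is determined by its values on the summands R and Q, and each such
  value splits into an R-part and a Q-part. On R x R the subalgebra hypothesis forces the R-part to
  be \<open>brR\<close> and the Q-part to vanish; the other three combinations of summands give six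
  components, and these are the extending datum. They are conformal bilinear because each arises
  from \<open>brE\<close> by composing with inclusions and a projection of the direct sum, which are
  module homomorphisms (\<open>conformal_bilinear_compose\<close>). Reassembling the components
  (\<open>pair_poly_fst_snd\<close>) gives back \<open>brE\<close> itself, so the unified product
  equals E and the identity is the required isomorphism.\<close>

text \<open>Homomorphisms over the polynomial ring commute with both complex scalars and \<partial>.
  Multiplication by \<lambda> only shifts coefficients, so it commutes with the coefficientwise
  action of the additive map \<open>h\<close>. Every law can thus be compared coefficient by
  coefficient.\<close>

lemma conformal_bilinear_compose:
  assumes "conformal_bilinear sU sV sW g"
    and "module_hom sU' sU i" and "module_hom sV' sV j" and "module_hom sW sW' h"
  shows "conformal_bilinear sU' sV' sW' (\<lambda>u v. map_poly h (g (i u) (j v)))"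
proof -
  interpret g: conformal_bilinear sU sV sW g by fact
  interpret i: module_hom sU' sU i by fact
  interpret j: module_hom sV' sV j by fact
  interpret h: module_hom sW sW' h by fact
  show ?thesis
  proof
    fix u u' v v' c
    show "map_poly h (g (i (u + u')) (j v)) = map_poly h (g (i u) (j v)) + map_poly h (g (i u') (j v))"
      by (rule poly_eqI) (simp add: coeff_map_poly i.add g.add_left h.add)
    show "map_poly h (g (i u) (j (v + v'))) = map_poly h (g (i u) (j v)) + map_poly h (g (i u) (j v'))"
      by (rule poly_eqI) (simp add: coeff_map_poly j.add g.add_right h.add)
    show "map_poly h (g (i (cscale sU' c u)) (j v)) = map_poly (cscale sW' c) (map_poly h (g (i u) (j v)))"
      by (rule poly_eqI) (simp add: coeff_map_poly i.scale g.cscale_left h.scale)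
    show "map_poly h (g (i u) (j (cscale sV' c v))) = map_poly (cscale sW' c) (map_poly h (g (i u) (j v)))"
      by (rule poly_eqI) (simp add: coeff_map_poly j.scale g.cscale_right h.scale)
    show "map_poly h (g (i (del sU' u)) (j v)) = - pCons 0 (map_poly h (g (i u) (j v)))"
      by (rule poly_eqI) (simp add: coeff_map_poly i.scale g.del_left h.neg coeff_pCons split: nat.split)
    show "map_poly h (g (i u) (j (del sV' v))) =
        map_poly (del sW') (map_poly h (g (i u) (j v))) + pCons 0 (map_poly h (g (i u) (j v)))"
      by (rule poly_eqI)
        (simp add: coeff_map_poly j.scale g.del_right h.scale h.add coeff_pCons split: nat.split)
  qed
qed

context module_prod
begin

lemma module_hom_fst: "module_hom scale s1 fst"
  by unfold_locales (auto simp: scale_def)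

lemma module_hom_snd: "module_hom scale s2 snd"
  by unfold_locales (auto simp: scale_def)

lemma module_hom_inl: "module_hom s1 scale (\<lambda>r. (r, 0))"
  by unfold_locales (auto simp: scale_def)

lemma module_hom_inr: "module_hom s2 scale (\<lambda>x. (0, x))"
  by unfold_locales (auto simp: scale_def)

end

text \<open>This reduces an identity between E-valued polynomials to one in R and one in Q.\<close>

lemma pair_poly_fst_snd: "pair_poly (map_poly fst p) (map_poly snd p) = p"
  by (rule poly_eqI) (simp add: pair_poly_def coeff_map_poly zero_prod_def)

theorem theorem3p5:
  fixes sR :: "complex poly \<Rightarrow> 'r::ab_group_add \<Rightarrow> 'r"
    and brR :: "'r \<Rightarrow> 'r \<Rightarrow> 'r poly"
    and sQ :: "complex poly \<Rightarrow> 'q::ab_group_add \<Rightarrow> 'q"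
    and brE :: "'r \<times> 'q \<Rightarrow> 'r \<times> 'q \<Rightarrow> ('r \<times> 'q) poly"
  assumes R: "leibniz_conformal_algebra sR brR"
    and Q: "module sQ"
    and E: "leibniz_conformal_algebra (prod_scale sR sQ) brE"
    and sub: "is_subalgebra_of_prod brR brE"
  shows "\<exists>(leftharp :: 'r \<Rightarrow> 'q \<Rightarrow> 'r poly) (rightharp :: 'r \<Rightarrow> 'q \<Rightarrow> 'q poly)
           (ltri :: 'q \<Rightarrow> 'r \<Rightarrow> 'q poly) (rtri :: 'q \<Rightarrow> 'r \<Rightarrow> 'r poly)
           (f :: 'q \<Rightarrow> 'q \<Rightarrow> 'r poly) (curly :: 'q \<Rightarrow> 'q \<Rightarrow> 'q poly).
           leibniz_conformal_extending_structure sR brR sQ leftharp rightharp ltri rtri f curly \<and>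
           (\<exists>\<phi> :: 'r \<times> 'q \<Rightarrow> 'r \<times> 'q.
              leibniz_conformal_iso (prod_scale sR sQ) brE (prod_scale sR sQ)
                (unified_bracket brR leftharp rightharp ltri rtri f curly) \<phi> \<and>
              stabilizes_left \<phi> \<and> costabilizes_right \<phi>)"
proof -
  interpret R: leibniz_conformal_algebra sR brR by fact
  interpret E: leibniz_conformal_algebra "prod_scale sR sQ" brE by fact
  interpret Q: module sQ by fact
  interpret P: module_prod sR sQ ..
  note homs = P.module_hom_inl P.module_hom_inr P.module_hom_fst P.module_hom_snd
  note compose = conformal_bilinear_compose[OF E.conformal_bilinear_axioms]
  define leftharp where "leftharp a y = map_poly fst (brE (a, 0) (0, y))" for a y
  define rightharp where "rightharp a y = map_poly snd (brE (a, 0) (0, y))" for a y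
  define ltri where "ltri x b = map_poly snd (brE (0, x) (b, 0))" for x b
  define rtri where "rtri x b = map_poly fst (brE (0, x) (b, 0))" for x b
  define f where "f x y = map_poly fst (brE (0, x) (0, y))" for x y
  define curly where "curly x y = map_poly snd (brE (0, x) (0, y))" for x y
  note defs = leftharp_def rightharp_def ltri_def rtri_def f_def curly_def

  have unified: "unified_bracket brR leftharp rightharp ltri rtri f curly = brE"
  proof (intro ext)
    fix u v :: "'r \<times> 'q"
    obtain a x where u: "u = (a, x)" by fastforce
    obtain b y where v: "v = (b, y)" by fastforce
    \<comment> \<open>Biadditivity, applied to (a, x) = (a, 0) + (0, x) and likewise to (b,
      y).\<close>
    have "brE u v = brE (a, 0) (b, 0) + brE (a, 0) (0, y) + brE (0, x) (b, 0) + brE (0, x) (0, y)"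
      using E.add_left[of "(a, 0)" "(0, x)"] E.add_right[of _ "(b, 0)" "(0, y)"] by (simp add: u v)
    \<comment> \<open>This summand has no Q-part, which matches the Q-component of
      \<open>unified_bracket\<close> having three terms against four in the R-component.\<close>
    moreover have "brE (a, 0) (b, 0) = map_poly (\<lambda>r. (r, 0)) (brR a b)"
      using sub by (simp add: is_subalgebra_of_prod_def)
    ultimately have br: "brE u v = map_poly (\<lambda>r. (r, 0)) (brR a b)
        + brE (a, 0) (0, y) + brE (0, x) (b, 0) + brE (0, x) (0, y)"
      by simp
    have "map_poly fst (brE u v) = brR a b + leftharp a y + rtri x b + f x y"
      by (rule poly_eqI) (simp add: br defs coeff_map_poly zero_prod_def)
    moreover have "map_poly snd (brE u v) = rightharp a y + ltri x b + curly x y"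
      by (rule poly_eqI) (simp add: br defs coeff_map_poly zero_prod_def)
    ultimately show "unified_bracket brR leftharp rightharp ltri rtri f curly u v = brE u v"
      using pair_poly_fst_snd[of "brE u v"] by (simp add: unified_bracket_def u v)
  qed

  have "conformal_bilinear sR sQ sR leftharp" "conformal_bilinear sR sQ sQ rightharp"
    "conformal_bilinear sQ sR sQ ltri" "conformal_bilinear sQ sR sR rtri"
    "conformal_bilinear sQ sQ sR f" "conformal_bilinear sQ sQ sQ curly"
    \<comment> \<open>In each case \<open>i\<close> and \<open>j\<close> are inclusions of R or Q
      into E, and \<open>h\<close> is a projection.\<close>
    unfolding defs[abs_def] by (intro compose homs)+
  then have "extending_datum sR brR sQ leftharp rightharp ltri rtri f curly"
    using R Q by (simp add: extending_datum_def)
  \<comment> \<open>The Leibniz identity for the unified bracket is that of E, since the two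
    brackets are equal; no compatibility conditions among the six maps have to be checked
    separately.\<close>
  then have "leibniz_conformal_extending_structure sR brR sQ leftharp rightharp ltri rtri f curly"
    using E by (simp add: leibniz_conformal_extending_structure_def unified)
  moreover have "leibniz_conformal_iso (prod_scale sR sQ) brE (prod_scale sR sQ)
      (unified_bracket brR leftharp rightharp ltri rtri f curly) id"
    by (simp add: leibniz_conformal_iso_def unified E.U.module_hom_id)
  moreover have "stabilizes_left id" "costabilizes_right id"
    by (simp_all add: stabilizes_left_def costabilizes_right_def)
  ultimately show ?thesis by blast
qed

end
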